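(* Let $\delta$ be a positive integer that is not a perfect square. Then there exists an integer $s\ge1$ such that for every integer $n\ge0$, $$[\overline{2,1,1,1,(s,1,1,2,1,1)^n,s,1,2,1,1,1,1,s,(1,1,2,1,1,s)^n}]\in\mathbb{Q}[\sqrt{\delta}].$$
   Context: $[\overline{u_1,\dots,u_p}]$ denotes the real number whose continued fraction expansion is purely periodic with period $(u_1,\dots,u_p)$. The notation $(u_1,\dots,u_k)^n$ means that the pattern $u_1,\dots,u_k$ is repeated $n$ times. *)

theory Defs
  imports Complex_Main "HOL-Computational_Algebra.Nth_Powers"
begin

text \<open>
  The \<open>k\<close>-th convergent \<open>u\<^sub>0 + 1/(u\<^sub>1 + 1/(\<dots> + 1/u\<^sub>k))\<close> of the simple continued fraction with
  partial quotients \<open>u\<^sub>0, u\<^sub>1, \<dots>\<close>.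
\<close>
primrec cf_convergent :: "(nat \<Rightarrow> nat) \<Rightarrow> nat \<Rightarrow> real" where
  "cf_convergent u 0 = real (u 0)"
| "cf_convergent u (Suc k) = real (u 0) + 1 / cf_convergent (\<lambda>i. u (Suc i)) k"

text \<open>
  The limit exists whenever all partial quotients are positive; otherwise the value of
  \<^const>\<open>lim\<close> is unspecified.
\<close>
definition cf_value :: "(nat \<Rightarrow> nat) \<Rightarrow> real" where
  "cf_value u = lim (cf_convergent u)"

text \<open>
  The number denoted by overlined square brackets around \<open>us\<close>. Here \<open>us\<close> must be nonempty, but
  its length need not be the least period.
\<close>
definition periodic_cf :: "nat list \<Rightarrow> real" where
  "periodic_cf us = cf_value (\<lambda>i. us ! (i mod length us))"

definition list_repeat :: "nat \<Rightarrow> 'a list \<Rightarrow> 'a list" where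
  "list_repeat n us = concat (replicate n us)"

definition Q_sqrt :: "nat \<Rightarrow> real set" where
  "Q_sqrt d = {a + b * sqrt (real d) | a b. a \<in> \<rat> \<and> b \<in> \<rat>}"

end

theory Submission
  imports Defs "HOL-Analysis.Kronecker_Approximation_Theorem" "HOL-Computational_Algebra.Polynomial"
begin

text \<open>
  The value of a periodic continued fraction is a fixed point of the product \<open>M\<close> of the matrices
  \<open>(k 1; 1 0)\<close> over its period, so it lies in the quadratic field of discriminant
  \<open>(tr M)\<^sup>2 - 4 det M\<close>. Put \<open>P = M(s,1,1,2,1,1)\<close> and \<open>Q = M(1,1,2,1,1,s)\<close>. Since \<open>1,1,2,1,1\<close> is a
  palindrome, \<open>Q\<close> is the transpose of \<open>P\<close>; in particular both have trace \<open>12 s + 14\<close> and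
  determinant 1, so by Cayley-Hamilton \<open>P\<^sup>n = x P + y\<close> and \<open>Q\<^sup>n = x Q + y\<close> with the same \<open>x\<close>, \<open>y\<close>.
  It follows that the matrix of the whole period has determinant 1 and trace \<open>t\<^sup>2 - 2\<close> with
  \<open>t = tr (P\<^bsup>n+1\<^esup>)\<close>. Its discriminant is therefore \<open>t\<^sup>2 (t\<^sup>2 - 4)\<close>, which is
  \<open>(12 s + 14)\<^sup>2 - 4\<close> up to a square factor, for every \<open>n\<close>. It remains to find
  \<open>s\<close> for which \<open>(6 s + 7)\<^sup>2 - 1\<close> is \<open>\<delta>\<close> times a square: take the fourth power of any nontrivial
  solution of the Pell equation, whose first component is congruent to 1 modulo 6.
\<close>

section \<open>Pell's equation\<close>

lemma sqrt_nat_irrational: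
  fixes d :: nat
  assumes "\<not> is_square d"
  shows "sqrt (real d) \<notin> \<rat>"
proof
  assume rat: "sqrt (real d) \<in> \<rat>"
  have "algebraic_int (sqrt (real d))"
    by (intro algebraic_int_sqrt) auto
  with rat have "sqrt (real d) \<in> \<int>"
    by (rule rational_algebraic_int_is_int[rotated])
  then obtain z where z: "sqrt (real d) = of_int z" by (auto elim: Ints_cases)
  have "real d = of_int (z\<^sup>2)"
    using arg_cong[OF z, of "\<lambda>x. x\<^sup>2"] by simp
  then have "int d = z\<^sup>2" by linarith
  then have "d = nat \<bar>z\<bar> ^ 2"
    by (metis nat_abs_mult_distrib nat_int power2_eq_square abs_of_nat)
  with assms show False by (auto intro: is_nth_powerI)
qed

lemma norm_form_nonzero:
  fixes d :: nat and h k :: int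
  assumes "\<not> is_square d" and "k \<noteq> 0"
  shows "h\<^sup>2 - int d * k\<^sup>2 \<noteq> 0"
proof
  assume "h\<^sup>2 - int d * k\<^sup>2 = 0"
  then have "real_of_int (h\<^sup>2) = real_of_int (int d * k\<^sup>2)" by simp
  then have "real d = (of_int h / of_int k)\<^sup>2"
    using assms(2) by (simp add: field_simps)
  then have "sqrt (real d) = \<bar>of_int h / of_int k\<bar>"
    by simp
  moreover have "\<bar>of_int h / of_int k\<bar> \<in> (\<rat> :: real set)" by simp
  ultimately show False using sqrt_nat_irrational[OF assms(1)] by simp
qed

text \<open>With \<open>r = sqrt d\<close>, the norm factors as \<open>(h - k r) (h + k r)\<close>.
  A good approximation makes the first factor at most \<open>1 / k\<close> in absolute value, while
  the second is at most \<open>k (2 r + 1)\<close>. The bound is independent of \<open>h\<close> and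
  \<open>k\<close>, as the pigeonhole argument requires.\<close>

lemma norm_form_bound:
  assumes "(h, k) \<in> approx_set (sqrt (real d))"
  shows "\<bar>h\<^sup>2 - int d * k\<^sup>2\<bar> \<le> \<lceil>2 * sqrt (real d) + 1\<rceil>"
proof -
  let ?r = "sqrt (real d)"
  have k: "k > 0" and app: "\<bar>?r - of_int h / of_int k\<bar> < 1 / of_int (k\<^sup>2)"
    using assms by (auto simp: approx_set_def)
  have k1: "real_of_int k \<ge> 1" using k by simp
  have "of_int k * ?r - of_int h = of_int k * (?r - of_int h / of_int k)"
    using k by (simp add: field_simps)
  then have "\<bar>of_int k * ?r - of_int h\<bar> = of_int k * \<bar>?r - of_int h / of_int k\<bar>"
    using k by (simp add: abs_mult)
  also have "\<dots> \<le> of_int k * (1 / of_int (k\<^sup>2))"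
    using app k by (intro mult_left_mono) auto
  also have "\<dots> = 1 / of_int k"
    using k by (simp add: power2_eq_square)
  finally have e: "\<bar>of_int k * ?r - of_int h\<bar> \<le> 1 / of_int k" .
  then have "\<bar>of_int k * ?r - of_int h\<bar> \<le> 1"
    using k1 by (elim order_trans) simp
  moreover have "0 \<le> of_int k * ?r" using k by simp
  ultimately have "\<bar>of_int h + of_int k * ?r\<bar> \<le> 2 * (of_int k * ?r) + 1" by linarith
  also have "\<dots> \<le> of_int k * (2 * ?r + 1)"
    using k1 by (simp add: algebra_simps)
  finally have f: "\<bar>of_int h + of_int k * ?r\<bar> \<le> of_int k * (2 * ?r + 1)" .
  have "\<bar>real_of_int (h\<^sup>2 - int d * k\<^sup>2)\<bar>
      = \<bar>of_int k * ?r - of_int h\<bar> * \<bar>of_int h + of_int k * ?r\<bar>"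
    unfolding abs_mult[symmetric]
    by (simp add: algebra_simps power2_eq_square abs_minus_commute)
  also have "\<dots> \<le> (1 / of_int k) * (of_int k * (2 * ?r + 1))"
    using e f k by (intro mult_mono) auto
  also have "\<dots> = 2 * ?r + 1" using k by simp
  finally have "\<bar>real_of_int (h\<^sup>2 - int d * k\<^sup>2)\<bar> \<le> 2 * ?r + 1" .
  then show ?thesis by linarith
qed

text \<open>Infinitely many good approximations have bounded norm, so two of them share a norm
  \<open>m\<close> and are congruent modulo \<open>m\<close>. Their quotient in Z[sqrt d] is then a
  nontrivial element of norm 1.\<close>

lemma pell_solution_exists:
  fixes d :: nat
  assumes "\<not> is_square d"
  obtains x y :: int where "x\<^sup>2 - int d * y\<^sup>2 = 1" and "y \<noteq> 0"
proof -
  define A where "A = approx_set (sqrt (real d))"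
  define N where "N = (\<lambda>(h, k). h\<^sup>2 - int d * k\<^sup>2)"
  define B where "B = \<lceil>2 * sqrt (real d) + 1\<rceil>"
  have infA: "infinite A"
    using sqrt_nat_irrational[OF assms] by (simp add: A_def rational_iff_finite_approx_set)
  have "N ` A \<subseteq> {-B..B}"
    using norm_form_bound by (fastforce simp: A_def N_def B_def abs_le_iff)
  then have "finite (N ` A)" by (rule finite_subset) simp
  then obtain a0 where "a0 \<in> A" and inf1: "infinite {a \<in> A. N a = N a0}"
    using pigeonhole_infinite[OF infA] by blast
  define m where "m = N a0"
  define A' where "A' = {a \<in> A. N a = m}"
  have m0: "m \<noteq> 0"
    using \<open>a0 \<in> A\<close> norm_form_nonzero[OF assms]
    by (auto simp: m_def N_def A_def approx_set_def split: prod.splits)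
  define R where "R = (\<lambda>(h, k). (h mod \<bar>m\<bar>, k mod \<bar>m\<bar>))"
  have "R ` A' \<subseteq> {0..<\<bar>m\<bar>} \<times> {0..<\<bar>m\<bar>}"
    using m0 by (auto simp: R_def)
  then have "finite (R ` A')" by (rule finite_subset) simp
  then obtain a1 where "a1 \<in> A'" and inf2: "infinite {a \<in> A'. R a = R a1}"
    using pigeonhole_infinite inf1 unfolding A'_def m_def by blast
  have "infinite ({a \<in> A'. R a = R a1} - {a1})" using inf2 by simp
  then have "{a \<in> A'. R a = R a1} - {a1} \<noteq> {}" by (rule infinite_imp_nonempty)
  then obtain a2 where "a2 \<in> A'" "R a2 = R a1" "a2 \<noteq> a1" by blast
  obtain h k where a1: "a1 = (h, k)" by force
  obtain h' k' where a2: "a2 = (h', k')" by force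
  have nrm: "h\<^sup>2 - int d * k\<^sup>2 = m" "h'\<^sup>2 - int d * k'\<^sup>2 = m"
    using \<open>a1 \<in> A'\<close> \<open>a2 \<in> A'\<close> by (auto simp: A'_def a1 a2 N_def)
  have cop: "coprime h k" "k > 0" "coprime h' k'" "k' > 0"
    using \<open>a1 \<in> A'\<close> \<open>a2 \<in> A'\<close> by (auto simp: A'_def a1 a2 A_def approx_set_def)
  have "m dvd h' - h" "m dvd k' - k"
    using \<open>R a2 = R a1\<close> by (auto simp: R_def a1 a2 mod_eq_dvd_iff)
  then obtain p q where pq: "h' = h + m * p" "k' = k + m * q"
    by (metis dvdE add.commute diff_add_cancel)
  \<comment> \<open>\<open>x + y sqrt d\<close> is the quotient
    \<open>(h' + k' sqrt d) / (h + k sqrt d)\<close>; the congruences modulo \<open>m\<close> make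
    it integral.\<close>
  define x where "x = 1 + h * p - int d * k * q"
  define y where "y = h * q - k * p"
  have mx: "h * h' - int d * k * k' = m * x"
    using nrm(1) unfolding x_def pq by (simp add: algebra_simps power2_eq_square)
  have my: "h * k' - h' * k = m * y"
    unfolding y_def pq by (simp add: algebra_simps)
  have "m\<^sup>2 * (x\<^sup>2 - int d * y\<^sup>2) = (m * x)\<^sup>2 - int d * (m * y)\<^sup>2"
    by (simp add: algebra_simps power2_eq_square)
  also have "\<dots> = (h\<^sup>2 - int d * k\<^sup>2) * (h'\<^sup>2 - int d * k'\<^sup>2)"
    unfolding mx[symmetric] my[symmetric] by (simp add: algebra_simps power2_eq_square)
  also have "\<dots> = m\<^sup>2 * 1" unfolding nrm by (simp add: power2_eq_square)
  finally have "x\<^sup>2 - int d * y\<^sup>2 = 1" using m0 by simp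
  moreover have "y \<noteq> 0"
  proof
    assume "y = 0"
    \<comment> \<open>Equal fractions in lowest terms with positive denominators would make the two
      pairs equal.\<close>
    then have eq: "h * k' = h' * k" using my by simp
    have "k dvd k'"
      using cop(1) by (metis eq coprime_commute coprime_dvd_mult_right_iff dvd_triv_right)
    moreover have "k' dvd k"
      using cop(3) by (metis eq coprime_commute coprime_dvd_mult_right_iff dvd_triv_right)
    ultimately have "k = k'" using cop by (simp add: zdvd_antisym_nonneg)
    then have "h = h'" using eq cop by simp
    with \<open>k = k'\<close> show False using \<open>a2 \<noteq> a1\<close> a1 a2 by simp
  qed
  ultimately show ?thesis by (rule that)
qed

text \<open>Since 3 divides \<open>x^2 (x^2 - 1) = 3 w\<close>, the fourth power has first component
  \<open>24 w + 1\<close>, which is \<open>6 s + 7\<close> for \<open>s = 4 w - 1\<close>.\<close>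

lemma pell_solution_cong_1_mod_6:
  fixes d :: nat
  assumes "\<not> is_square d"
  obtains s :: nat and v :: int where "s \<ge> 1" and "(6 * int s + 7)\<^sup>2 - 1 = int d * v\<^sup>2"
proof -
  obtain x y :: int where xy: "x\<^sup>2 - int d * y\<^sup>2 = 1" "y \<noteq> 0"
    using pell_solution_exists[OF assms] .
  \<comment> \<open>The aim is \<open>x^2 >= 4\<close>, which makes \<open>w\<close> positive and
    hence \<open>s >= 1\<close>.\<close>
  have "is_square (0 :: nat)" "is_square (1 :: nat)"
    by (rule is_nth_powerI[of _ 0], simp, rule is_nth_powerI[of _ 1], simp)
  then have "d \<noteq> 0" "d \<noteq> 1" using assms by metis+
  then have "int d \<ge> 2" by linarith
  moreover have "y\<^sup>2 > 0" using xy(2) by simp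
  ultimately have "int d * y\<^sup>2 \<ge> 2 * 1" by (intro mult_mono) linarith+
  then have "x\<^sup>2 \<ge> 3" using xy(1) by linarith
  have "x\<^sup>2 \<noteq> 3"
  proof
    assume "x\<^sup>2 = 3"
    moreover have "\<bar>x\<bar> \<le> 1 \<or> \<bar>x\<bar> \<ge> 2" by linarith
    ultimately show False
      using power_mono[of "\<bar>x\<bar>" 1 2] power_mono[of 2 "\<bar>x\<bar>" 2] by auto
  qed
  with \<open>x\<^sup>2 \<ge> 3\<close> have x4: "x\<^sup>2 \<ge> 4" by linarith
  have "x\<^sup>2 mod 3 = 0 \<or> x\<^sup>2 mod 3 = 1"
  proof -
    have "x mod 3 = 0 \<or> x mod 3 = 1 \<or> x mod 3 = 2" by presburger
    then show ?thesis by (auto simp: power_mod[symmetric, of x])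
  qed
  then have "3 dvd x\<^sup>2 \<or> 3 dvd x\<^sup>2 - 1" by presburger
  then have "3 dvd x\<^sup>2 * (x\<^sup>2 - 1)" by (auto intro: dvd_mult dvd_mult2)
  then obtain w where w: "x\<^sup>2 * (x\<^sup>2 - 1) = 3 * w" by (elim dvdE)
  have "x\<^sup>2 * (x\<^sup>2 - 1) \<ge> 4 * 3" using x4 by (intro mult_mono) auto
  then have w4: "w \<ge> 4" using w by linarith
  define s where "s = nat (4 * w - 1)"
  have s: "int s = 4 * w - 1" using w4 by (simp add: s_def)
  \<comment> \<open>The fourth power of a solution has first component \<open>8 x\<^sup>4 - 8 x\<^sup>2 + 1\<close>.\<close>
  have s6: "6 * int s + 7 = 8 * (x\<^sup>2 * (x\<^sup>2 - 1)) + 1" using s w by simp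
  have dy: "int d * y\<^sup>2 = x\<^sup>2 - 1" using xy(1) by simp
  have "(6 * int s + 7)\<^sup>2 - 1 = (x\<^sup>2 - 1) * (8 * x^3 - 4 * x)\<^sup>2"
    unfolding s6 by algebra
  also have "\<dots> = int d * (y * (8 * x^3 - 4 * x))\<^sup>2"
    unfolding dy[symmetric] by (simp add: power_mult_distrib)
  finally have "(6 * int s + 7)\<^sup>2 - 1 = int d * (y * (8 * x^3 - 4 * x))\<^sup>2" .
  moreover have "s \<ge> 1" using w4 s by linarith
  ultimately show ?thesis by (rule that[rotated])
qed

section \<open>Matrices of continued fractions\<close>

text \<open>Explicit integer entries reduce matrix claims to polynomial identities, and the
  \<open>monoid_mult\<close> instance supplies powers and \<open>prod_list\<close>.\<close>

datatype mat2 = Mat2 (m11: int) (m12: int) (m21: int) (m22: int)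

instantiation mat2 :: monoid_mult
begin

definition one_mat2 :: mat2 where "one_mat2 = Mat2 1 0 0 1"

definition times_mat2 :: "mat2 \<Rightarrow> mat2 \<Rightarrow> mat2" where
  "times_mat2 A B = Mat2
     (m11 A * m11 B + m12 A * m21 B) (m11 A * m12 B + m12 A * m22 B)
     (m21 A * m11 B + m22 A * m21 B) (m21 A * m12 B + m22 A * m22 B)"

instance
  by standard (auto simp: one_mat2_def times_mat2_def algebra_simps)

end

definition mat2_tr :: "mat2 \<Rightarrow> int" where
  "mat2_tr A = m11 A + m22 A"

definition mat2_det :: "mat2 \<Rightarrow> int" where
  "mat2_det A = m11 A * m22 A - m12 A * m21 A"

lemma mat2_det_mult: "mat2_det (A * B) = mat2_det A * mat2_det B"
  by (simp add: mat2_det_def times_mat2_def algebra_simps)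

text \<open>This is \<open>x A + y I\<close>, the shape that Cayley-Hamilton gives to every power of
  \<open>A\<close>.\<close>

definition mat2_lin :: "int \<Rightarrow> mat2 \<Rightarrow> int \<Rightarrow> mat2" where
  "mat2_lin x A y = Mat2 (x * m11 A + y) (x * m12 A) (x * m21 A) (x * m22 A + y)"

text \<open>Cayley-Hamilton for determinant 1: \<open>A^2 = tr(A) A - I\<close>.\<close>

lemma mat2_lin_mult_self:
  assumes "mat2_det A = 1"
  shows "mat2_lin x A y * A = mat2_lin (x * mat2_tr A + y) A (- x)"
proof -
  obtain p q r s where A: "A = Mat2 p q r s" by (cases A)
  then have "p * s = q * r + 1" using assms by (simp add: mat2_det_def)
  then have "x * (p * s) = x * (q * r) + x" by (simp add: ring_distribs)
  then show ?thesis
    by (simp add: A mat2_lin_def times_mat2_def mat2_tr_def algebra_simps)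
qed

text \<open>The recursion \<open>(x, y) -> (x tr(A) + y, -x)\<close> sees only the trace, so
  \<open>A\<close> and \<open>B\<close> share coefficients. The quadratic form in \<open>x\<close>
  and \<open>y\<close> is \<open>det (x A + y I) = det (A^n)\<close>.\<close>

lemma mat2_powers_lin:
  assumes "mat2_det A = 1" "mat2_det B = 1" "mat2_tr B = mat2_tr A"
  obtains x y where "x\<^sup>2 + x * y * mat2_tr A + y\<^sup>2 = 1"
    and "A ^ n = mat2_lin x A y" and "B ^ n = mat2_lin x B y"
proof -
  have "\<exists>x y. x\<^sup>2 + x * y * mat2_tr A + y\<^sup>2 = 1 \<and> A ^ n = mat2_lin x A y \<and> B ^ n = mat2_lin x B y"
  proof (induction n)
    case 0
    show ?case
      by (rule exI[of _ 0], rule exI[of _ 1]) (simp add: mat2_lin_def one_mat2_def)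
  next
    case (Suc n)
    then obtain x y where xy: "x\<^sup>2 + x * y * mat2_tr A + y\<^sup>2 = 1"
      "A ^ n = mat2_lin x A y" "B ^ n = mat2_lin x B y" by blast
    have "(x * mat2_tr A + y)\<^sup>2 + (x * mat2_tr A + y) * (- x) * mat2_tr A + (- x)\<^sup>2 = 1"
      using xy(1) by algebra
    moreover have "A ^ Suc n = mat2_lin (x * mat2_tr A + y) A (- x)"
      using xy(2) mat2_lin_mult_self[OF assms(1)] by (simp add: power_Suc2 del: power_Suc)
    moreover have "B ^ Suc n = mat2_lin (x * mat2_tr A + y) B (- x)"
      using xy(3) mat2_lin_mult_self[OF assms(2)] assms(3)
      by (simp add: power_Suc2 del: power_Suc)
    ultimately show ?case by blast
  qed
  with that show ?thesis by blast
qed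

definition cf_mat :: "nat list \<Rightarrow> mat2" where
  "cf_mat us = prod_list (map (\<lambda>k. Mat2 (int k) 1 1 0) us)"

lemma cf_mat_Nil [simp]: "cf_mat [] = 1"
  and cf_mat_Cons: "cf_mat (k # us) = Mat2 (int k) 1 1 0 * cf_mat us"
  and cf_mat_append: "cf_mat (us @ vs) = cf_mat us * cf_mat vs"
  by (simp_all add: cf_mat_def)

lemma set_list_repeat_subset: "set (list_repeat n us) \<subseteq> set us"
  by (auto simp: list_repeat_def)

lemma cf_mat_list_repeat: "cf_mat (list_repeat n us) = cf_mat us ^ n"
  by (induction n) (simp_all add: list_repeat_def cf_mat_append)

lemma mat2_det_cf_mat: "mat2_det (cf_mat us) = (-1) ^ length us"
proof (induction us)
  case Nil
  then show ?case by (simp add: mat2_det_def one_mat2_def)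
next
  case (Cons k us)
  then show ?case by (simp add: cf_mat_Cons mat2_det_mult) (simp add: mat2_det_def)
qed

text \<open>The last entry is only nonnegative because it vanishes for a one-element list.\<close>

lemma cf_mat_pos:
  assumes "us \<noteq> []" "\<And>k. k \<in> set us \<Longrightarrow> k > 0"
  shows "m11 (cf_mat us) > 0 \<and> m12 (cf_mat us) > 0 \<and> m21 (cf_mat us) > 0 \<and> m22 (cf_mat us) \<ge> 0"
  using assms
proof (induction us rule: list_nonempty_induct)
  case (single k)
  then show ?case by (simp add: cf_mat_def)
next
  case (cons k us)
  then show ?case by (auto simp: cf_mat_Cons times_mat2_def intro!: add_pos_pos add_pos_nonneg)
qed

section \<open>Values of periodic continued fractions\<close>

lemma cf_convergent_ge_1:
  assumes "\<And>i. u i \<ge> 1"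
  shows "cf_convergent u k \<ge> 1"
  using assms
proof (induction k arbitrary: u)
  case 0
  show ?case using 0[of 0] by simp
next
  case (Suc k)
  have "cf_convergent (\<lambda>i. u (Suc i)) k \<ge> 1"
    by (rule Suc.IH) (rule Suc.prems)
  moreover have "real (u 0) \<ge> 1" using Suc.prems[of 0] by simp
  ultimately show ?case by (simp add: add_increasing2)
qed

text \<open>Here \<open>y\<close> is a sequence of complete quotients. A single step need not
  contract by a fixed factor, since \<open>c1 * y1'\<close> is only bounded below by 1. Two steps
  divide the error by \<open>(c1 * c2) * (y1' * y2')\<close>, where \<open>c1 * c2\<close> is
  \<open>u 1 * c2 + 1 >= 2\<close>; hence the exponent \<open>k div 2\<close>.\<close>

lemma cf_convergent_error:
  fixes y :: "nat \<Rightarrow> real"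
  assumes "\<And>i. u i \<ge> 1" "\<And>i. y i > 0" "\<And>i. y i = real (u i) + 1 / y (Suc i)"
  shows "\<bar>cf_convergent u k - y 0\<bar> \<le> (1 / 2) ^ (k div 2)"
  using assms
proof (induction k arbitrary: u y rule: less_induct)
  case (less k)
  have u1: "real (u i) \<ge> 1" for i using less.prems(1)[of i] by simp
  have y1: "y i \<ge> 1" for i
    using u1[of i] less.prems(2)[of "Suc i"] by (subst less.prems(3)) (simp add: add_increasing2)
  have err0: "y 0 - real (u 0) = 1 / y (Suc 0)" using less.prems(3)[of 0] by linarith
  consider "k = 0" | "k = 1" | j where "k = Suc (Suc j)"
    by (metis One_nat_def not0_implies_Suc)
  then show ?case
  proof cases
    case 1
    then show ?thesis using err0 y1[of "Suc 0"] by (simp add: abs_minus_commute[of _ "y 0"])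
  next
    case 2
    have "0 < 1 / y (Suc 0)" "1 / y (Suc 0) \<le> 1" "0 < 1 / real (u (Suc 0))" "1 / real (u (Suc 0)) \<le> 1"
      using y1[of "Suc 0"] u1[of "Suc 0"] by auto
    then have "\<bar>1 / real (u (Suc 0)) - 1 / y (Suc 0)\<bar> \<le> 1" by linarith
    moreover have "cf_convergent u k - y 0 = 1 / real (u (Suc 0)) - 1 / y (Suc 0)"
      using err0 by (simp add: 2)
    ultimately show ?thesis by (simp add: 2)
  next
    case 3
    define c2 where "c2 = cf_convergent (\<lambda>i. u (Suc (Suc i))) j"
    define c1 where "c1 = real (u (Suc 0)) + 1 / c2"
    define y1' y2' where "y1' = y (Suc 0)" and "y2' = y (Suc (Suc 0))"
    have c2: "c2 \<ge> 1" unfolding c2_def by (rule cf_convergent_ge_1) (rule less.prems(1))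
    have y2: "y2' \<ge> 1" by (simp add: y2'_def y1)
    have yy: "y1' = real (u (Suc 0)) + 1 / y2'"
      unfolding y1'_def y2'_def by (rule less.prems(3))
    have IH: "\<bar>c2 - y2'\<bar> \<le> (1 / 2) ^ (j div 2)"
      unfolding c2_def y2'_def
    proof (rule less.IH[of j "\<lambda>i. u (Suc (Suc i))" "\<lambda>i. y (Suc (Suc i))"])
      show "j < k" by (simp add: 3)
    qed (rule less.prems)+
    have "c1 * c2 = real (u (Suc 0)) * c2 + 1" "y1' * y2' = real (u (Suc 0)) * y2' + 1"
      using c2 y2 by (simp_all add: c1_def yy distrib_right)
    moreover have "real (u (Suc 0)) * c2 \<ge> 1 * 1" "real (u (Suc 0)) * y2' \<ge> 1 * 1"
      using c2 y2 u1[of "Suc 0"] by (intro mult_mono; simp)+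
    ultimately have prods: "c1 * c2 \<ge> 2" "y1' * y2' \<ge> 2" by linarith+
    have c1: "c1 \<ge> 1" "y1' \<ge> 1"
      using c2 y2 u1[of "Suc 0"] by (auto simp: c1_def yy intro: add_increasing2)
    have "cf_convergent u k - y 0 = 1 / c1 - 1 / y1'"
      using err0 by (simp add: 3 c1_def c2_def y1'_def)
    also have "\<dots> = (y1' - c1) / (c1 * y1')"
      using c1 by (simp add: field_simps)
    also have "y1' - c1 = (c2 - y2') / (c2 * y2')"
      using c2 y2 by (simp add: c1_def yy field_simps)
    finally have "cf_convergent u k - y 0 = (c2 - y2') / ((c1 * c2) * (y1' * y2'))"
      by (simp add: ac_simps)
    then have "\<bar>cf_convergent u k - y 0\<bar> = \<bar>c2 - y2'\<bar> / \<bar>(c1 * c2) * (y1' * y2')\<bar>"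
      by (simp only: abs_divide)
    also have "\<dots> \<le> (1 / 2) ^ (j div 2) / 2"
    proof (rule frac_le[OF _ IH])
      have "2 * 1 \<le> (c1 * c2) * (y1' * y2')"
        using prods by (intro mult_mono) auto
      then show "2 \<le> \<bar>(c1 * c2) * (y1' * y2')\<bar>" by linarith
    qed auto
    finally show ?thesis by (simp add: 3)
  qed
qed

text \<open>The error bound also proves that the limit in \<open>cf_value\<close> exists, so any
  positive solution of the recursion identifies the value.\<close>

lemma cf_value_eq:
  fixes y :: "nat \<Rightarrow> real"
  assumes "\<And>i. u i \<ge> 1" "\<And>i. y i > 0" "\<And>i. y i = real (u i) + 1 / y (Suc i)"
  shows "cf_value u = y 0"
proof -
  have "filterlim (\<lambda>k::nat. k div 2) at_top sequentially"
    unfolding filterlim_at_top eventually_sequentially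
  proof safe
    fix Z :: nat
    show "\<exists>N. \<forall>n\<ge>N. Z \<le> n div 2" by (rule exI[of _ "2 * Z"]) auto
  qed
  moreover have "(\<lambda>n. (1 / 2 :: real) ^ n) \<longlonglongrightarrow> 0" by (rule LIMSEQ_power_zero) simp
  ultimately have lim0: "(\<lambda>k. (1 / 2 :: real) ^ (k div 2)) \<longlonglongrightarrow> 0"
    by (rule filterlim_compose[rotated])
  have "(\<lambda>k. cf_convergent u k - y 0) \<longlonglongrightarrow> 0"
    by (rule Lim_null_comparison[OF _ lim0]) (simp add: cf_convergent_error[where u = u and y = y, OF assms])
  then have "cf_convergent u \<longlonglongrightarrow> y 0" by (rule LIM_zero_cancel)
  then show ?thesis unfolding cf_value_def by (rule limI)
qed

section \<open>Continued fractions with a real tail, and fixed points of their Moebius maps\<close>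

definition cf_append :: "nat list \<Rightarrow> real \<Rightarrow> real" where
  "cf_append us x = foldr (\<lambda>k z. real k + 1 / z) us x"

lemma cf_append_Nil [simp]: "cf_append [] x = x"
  and cf_append_Cons: "cf_append (k # us) x = real k + 1 / cf_append us x"
  by (simp_all add: cf_append_def)

lemma cf_append_pos:
  assumes "x > 0"
  shows "cf_append us x > 0"
  using assms by (induction us) (auto simp: cf_append_Cons intro: add_nonneg_pos)

text \<open>Each map \<open>z -> k + 1 / z\<close> is the Moebius map of \<open>(k 1; 1 0)\<close>,
  and composition corresponds to matrix product. Positivity keeps the denominators nonzero.\<close>

lemma cf_append_moebius:
  fixes x :: real
  assumes "us \<noteq> []" "\<And>k. k \<in> set us \<Longrightarrow> k > 0" "x > 0"
  shows "cf_append us x = (m11 (cf_mat us) * x + m12 (cf_mat us)) / (m21 (cf_mat us) * x + m22 (cf_mat us))"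
  using assms
proof (induction us rule: list_nonempty_induct)
  case (single k)
  then show ?case by (simp add: cf_append_Cons cf_mat_def field_simps)
next
  case (cons k us)
  have pos: "real_of_int (m11 (cf_mat us)) * x + m12 (cf_mat us) > 0"
      "real_of_int (m21 (cf_mat us)) * x + m22 (cf_mat us) > 0"
    using cf_mat_pos[OF cons.hyps] cons.prems by (auto intro!: add_pos_pos add_pos_nonneg)
  have IH: "cf_append us x = (m11 (cf_mat us) * x + m12 (cf_mat us)) / (m21 (cf_mat us) * x + m22 (cf_mat us))"
    using cons by simp
  show ?case
    unfolding cf_append_Cons cf_mat_Cons IH using pos
    by (simp add: times_mat2_def add_divide_eq_iff) (simp add: algebra_simps)
qed

lemma periodic_cf_fixed_point:
  assumes "us \<noteq> []" "\<And>k. k \<in> set us \<Longrightarrow> k > 0" "x > 0" "cf_append us x = x"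
  shows "periodic_cf us = x"
proof -
  \<comment> \<open>The complete quotients: the rest of the current period, followed by the tail
    \<open>x\<close>.\<close>
  define y where "y = (\<lambda>i. cf_append (drop (i mod length us) us) x)"
  have step: "y i = real (us ! (i mod length us)) + 1 / y (Suc i)" for i
  proof -
    let ?j = "i mod length us"
    have j: "?j < length us" using assms(1) by simp
    have "y i = real (us ! ?j) + 1 / cf_append (drop (Suc ?j) us) x"
      using j by (simp add: y_def cf_append_Cons flip: Cons_nth_drop_Suc)
    \<comment> \<open>At the end of a period the left side is \<open>x\<close> and the index wraps
      to 0; the fixed-point hypothesis closes the cycle.\<close>
    also have "cf_append (drop (Suc ?j) us) x = y (Suc i)"
      using j assms(4) by (auto simp: y_def mod_Suc)
    finally show ?thesis .
  qed
  have quot: "us ! (i mod length us) \<ge> 1" for i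
    using assms(2)[of "us ! (i mod length us)"] assms(1) by (simp add: Suc_le_eq)
  have y_pos: "y i > 0" for i
    unfolding y_def by (rule cf_append_pos[OF assms(3)])
  have "periodic_cf us = y 0"
    unfolding periodic_cf_def by (rule cf_value_eq[where y = y, OF quot y_pos]) (rule step)
  also have "\<dots> = x" using assms(4) by (simp add: y_def)
  finally show ?thesis .
qed

text \<open>The value is the positive root of \<open>c x^2 + (e - a) x - b = 0\<close>, the
  fixed-point equation of \<open>M = (a b; c e)\<close>. Its discriminant
  \<open>(a - e)^2 + 4 b c\<close> equals \<open>tr(M)^2 - 4 det(M)\<close>.\<close>

theorem periodic_cf_eq:
  assumes "us \<noteq> []" "\<And>k. k \<in> set us \<Longrightarrow> k > 0"
  defines "M \<equiv> cf_mat us"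
  shows "periodic_cf us =
    (m11 M - m22 M + sqrt (of_int ((mat2_tr M)\<^sup>2 - 4 * mat2_det M))) / (2 * m21 M)"
proof -
  define a b c e where "a = real_of_int (m11 M)" and "b = real_of_int (m12 M)"
    and "c = real_of_int (m21 M)" and "e = real_of_int (m22 M)"
  have pos: "a > 0" "b > 0" "c > 0" "e \<ge> 0"
    using cf_mat_pos[OF assms(1,2)] by (auto simp: a_def b_def c_def e_def M_def)
  define r where "r = sqrt ((a - e)\<^sup>2 + 4 * b * c)"
  have r2: "r\<^sup>2 = (a - e)\<^sup>2 + 4 * b * c" using pos by (simp add: r_def)
  have "\<bar>a - e\<bar> < r"
    using pos unfolding r_def by (intro real_less_rsqrt) simp
  then have num: "a - e + r > 0" by linarith
  define x where "x = (a - e + r) / (2 * c)"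
  have x: "x > 0" using num pos by (simp add: x_def)
  have r_eq: "r = 2 * c * x - a + e" using pos by (simp add: x_def)
  \<comment> \<open>Substituting \<open>r_eq\<close> into \<open>r2\<close> yields the quadratic up
    to the factor \<open>4 * c\<close>.\<close>
  have "4 * c * (x * (c * x + e)) = 4 * c * (a * x + b)"
    using r2 unfolding r_eq by algebra
  then have "x * (c * x + e) = a * x + b"
    using pos by simp
  moreover have "c * x + e > 0" using pos x by (intro add_pos_nonneg) auto
  ultimately have "x = (a * x + b) / (c * x + e)" by (simp add: eq_divide_eq)
  then have "cf_append us x = x"
    using cf_append_moebius[OF assms(1,2) x] by (simp add: a_def b_def c_def e_def M_def)
  then have "periodic_cf us = x"
    using periodic_cf_fixed_point[OF assms(1,2) x] by blast
  moreover have "r = sqrt (of_int ((mat2_tr M)\<^sup>2 - 4 * mat2_det M))"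
    unfolding r_def
    by (rule arg_cong[of _ _ sqrt])
      (simp add: a_def b_def c_def e_def mat2_tr_def mat2_det_def power2_eq_square algebra_simps)
  ultimately show ?thesis by (simp add: x_def a_def c_def e_def)
qed

lemma periodic_cf_in_Q_sqrt:
  assumes "us \<noteq> []" "\<And>k. k \<in> set us \<Longrightarrow> k > 0"
    and "(mat2_tr (cf_mat us))\<^sup>2 - 4 * mat2_det (cf_mat us) = int d * w\<^sup>2"
  shows "periodic_cf us \<in> Q_sqrt d"
proof -
  define M where "M = cf_mat us"
  have "sqrt (of_int (int d * w\<^sup>2)) = \<bar>real_of_int w\<bar> * sqrt (real d)"
    by (simp add: real_sqrt_mult mult.commute)
  then have "periodic_cf us = of_int (m11 M - m22 M) / of_int (2 * m21 M)
      + of_int \<bar>w\<bar> / of_int (2 * m21 M) * sqrt (real d)"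
    using periodic_cf_eq[OF assms(1,2)] assms(3) by (simp add: M_def add_divide_distrib)
  moreover have "of_int (m11 M - m22 M) / of_int (2 * m21 M) \<in> (\<rat> :: real set)"
    "of_int \<bar>w\<bar> / of_int (2 * m21 M) \<in> (\<rat> :: real set)"
    by (intro Rats_divide Rats_of_int)+
  ultimately show ?thesis unfolding Q_sqrt_def by blast
qed

section \<open>The discriminant of the period\<close>

text \<open>As \<open>P^(n+1) = x P^2 + y P = (x T + y) P - x I\<close> and
  \<open>tr(P^2) = T^2 - 2\<close>, its trace is the \<open>t\<close> of the proof, and its
  discriminant \<open>t^2 - 4\<close> is \<open>(x T + y)^2\<close> times that of \<open>P\<close>.
  The latter, \<open>T^2 - 4\<close>, is \<open>4 ((6 s + 7)^2 - 1)\<close>.\<close>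

lemma discriminant_of_period:
  fixes s :: nat
  defines "us n \<equiv> [2, 1, 1, 1] @ list_repeat n [s, 1, 1, 2, 1, 1] @
         [s, 1, 2, 1, 1, 1, 1, s] @ list_repeat n [1, 1, 2, 1, 1, s]"
  shows "\<exists>w. (mat2_tr (cf_mat (us n)))\<^sup>2 - 4 * mat2_det (cf_mat (us n))
            = ((6 * int s + 7)\<^sup>2 - 1) * w\<^sup>2"
proof -
  define T where "T = 12 * int s + 14"
  define P where "P = cf_mat [s, 1, 1, 2, 1, 1]"
  define Q where "Q = cf_mat [1, 1, 2, 1, 1, s]"
  have PQ: "P = Mat2 (12 * int s + 7) (7 * int s + 4) 12 7"
    "Q = Mat2 (12 * int s + 7) 12 (7 * int s + 4) 7"
    by (simp_all add: P_def Q_def cf_mat_def times_mat2_def one_mat2_def)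
  have tr: "mat2_tr P = T" "mat2_tr Q = T"
    by (simp_all add: PQ mat2_tr_def T_def)
  have "mat2_det P = 1" "mat2_det Q = 1"
    by (simp_all add: P_def Q_def mat2_det_cf_mat)
  then obtain x y where xy: "x\<^sup>2 + x * y * T + y\<^sup>2 = 1"
    and pow: "P ^ n = mat2_lin x P y" "Q ^ n = mat2_lin x Q y"
    using mat2_powers_lin[of P Q n] tr by metis
  define M where "M = cf_mat (us n)"
  have M: "M = cf_mat [2, 1, 1, 1] * (mat2_lin x P y * (cf_mat [s, 1, 2, 1, 1, 1, 1, s] * mat2_lin x Q y))"
    unfolding M_def us_def cf_mat_append cf_mat_list_repeat
    by (simp only: pow flip: P_def Q_def)
  have "length (us n) = 12 + 12 * n"
    by (simp add: us_def list_repeat_def length_concat sum_list_replicate)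
  then have det: "mat2_det M = 1"
    by (simp add: M_def mat2_det_cf_mat)
  \<comment> \<open>Multiplying constants by \<open>x\<^sup>2 + x y T + y\<^sup>2 = det (P\<^sup>n) = 1\<close> turns the two claims on \<open>t\<close> into
    polynomial identities in \<open>x\<close>, \<open>y\<close>, \<open>s\<close>.\<close>
  define t where "t = x * (T\<^sup>2 - 2) + y * T"
  have "mat2_tr M = t\<^sup>2 - 2 * (x\<^sup>2 + x * y * T + y\<^sup>2)"
    unfolding M PQ t_def T_def
    by (simp add: mat2_tr_def mat2_lin_def cf_mat_def times_mat2_def one_mat2_def) algebra
  then have trM: "mat2_tr M = t\<^sup>2 - 2" by (simp add: xy)
  have "t\<^sup>2 - 4 * (x\<^sup>2 + x * y * T + y\<^sup>2) = (T\<^sup>2 - 4) * (x * T + y)\<^sup>2"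
    unfolding t_def by algebra
  then have t4: "t\<^sup>2 - 4 = (T\<^sup>2 - 4) * (x * T + y)\<^sup>2" by (simp add: xy)
  have "(mat2_tr M)\<^sup>2 - 4 * mat2_det M = t\<^sup>2 * (t\<^sup>2 - 4)"
    unfolding trM det by algebra
  also have "\<dots> = ((6 * int s + 7)\<^sup>2 - 1) * (2 * t * (x * T + y))\<^sup>2"
    unfolding t4 unfolding T_def by algebra
  finally show ?thesis unfolding M_def by blast
qed

theorem proposition7p4:
  fixes \<delta> :: nat
  assumes "\<delta> > 0"
    and "\<not> is_square \<delta>"
  shows "\<exists>s::nat. s \<ge> 1 \<and>
    (\<forall>n::nat.
      periodic_cf
        ([2, 1, 1, 1] @ list_repeat n [s, 1, 1, 2, 1, 1] @
         [s, 1, 2, 1, 1, 1, 1, s] @ list_repeat n [1, 1, 2, 1, 1, s])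
      \<in> Q_sqrt \<delta>)"
proof -
  obtain s :: nat and v :: int where s: "s \<ge> 1" "(6 * int s + 7)\<^sup>2 - 1 = int \<delta> * v\<^sup>2"
    using pell_solution_cong_1_mod_6[OF assms(2)] .
  have "periodic_cf
        ([2, 1, 1, 1] @ list_repeat n [s, 1, 1, 2, 1, 1] @
         [s, 1, 2, 1, 1, 1, 1, s] @ list_repeat n [1, 1, 2, 1, 1, s])
      \<in> Q_sqrt \<delta>" (is "periodic_cf ?us \<in> _") for n
  proof -
    \<comment> \<open>Only the square factor \<open>w\<close> varies with \<open>n\<close>, so one
      \<open>s\<close> serves every \<open>n\<close>.\<close>
    obtain w where "(mat2_tr (cf_mat ?us))\<^sup>2 - 4 * mat2_det (cf_mat ?us)
        = ((6 * int s + 7)\<^sup>2 - 1) * w\<^sup>2"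
      using discriminant_of_period by blast
    then have "(mat2_tr (cf_mat ?us))\<^sup>2 - 4 * mat2_det (cf_mat ?us) = int \<delta> * (v * w)\<^sup>2"
      unfolding s(2) by (simp add: power_mult_distrib)
    then show ?thesis
      using s(1) by (intro periodic_cf_in_Q_sqrt) (auto dest!: subsetD[OF set_list_repeat_subset])
  qed
  with s(1) show ?thesis by blast
qed

end
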